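(* Let $m\ge 2$ be a fixed integer, and for each $n\ge 1$ let $L_{n,m}$ be the length of the longest common pattern contained in $m$ independent uniformly random permutations $\pi_1,\dots,\pi_m\in S_n$. Then $$\liminf_{n\to\infty}\frac{\mathbb{E}(L_{n,m})}{n^{\frac{m}{2m-1}}}\ge\frac12 .$$
   Context: A permutation $\sigma=\sigma_1\cdots\sigma_k\in S_k$ (with $k\le n$) is a pattern contained in $\pi=\pi_1\cdots\pi_n\in S_n$ if there are indices $i_1<i_2<\dots<i_k$ such that $\pi_{i_1}\pi_{i_2}\cdots\pi_{i_k}$ is order isomorphic to $\sigma$, i.e. for all $a,b$, $\pi_{i_a}<\pi_{i_b}$ if and only if $\sigma_a<\sigma_b$. Given $\pi_1,\dots,\pi_m\in S_n$, a common pattern is a permutation $\sigma$ that is a pattern contained in all of the $\pi_i$; a longest common pattern is a common pattern of maximum length. *)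

theory Defs
  imports "HOL-Probability.Product_PMF" "HOL-Combinatorics.Permutations"
begin

(* S_n is rendered as the set of functions p with p permutes {1..n}; such a p is
   the identity outside {1..n}, so this set has exactly n! elements. *)
definition sym_group :: "nat \<Rightarrow> (nat \<Rightarrow> nat) set" where
  "sym_group n = {p. p permutes {1..n}}"

(* s (in S_k) is a pattern contained in p (in S_n); the indices i_1 < ... < i_k
   are the values of the function i on {1..k}. *)
definition contains_pattern :: "nat \<Rightarrow> (nat \<Rightarrow> nat) \<Rightarrow> nat \<Rightarrow> (nat \<Rightarrow> nat) \<Rightarrow> bool" where
  "contains_pattern n p k s \<longleftrightarrow>
     k \<le> n \<and>
     (\<exists>i. i ` {1..k} \<subseteq> {1..n} \<and> strict_mono_on {1..k} i \<and>
          (\<forall>a\<in>{1..k}. \<forall>b\<in>{1..k}. p (i a) < p (i b) \<longleftrightarrow> s a < s b))"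

definition common_pattern ::
    "nat \<Rightarrow> nat \<Rightarrow> (nat \<Rightarrow> nat \<Rightarrow> nat) \<Rightarrow> nat \<Rightarrow> (nat \<Rightarrow> nat) \<Rightarrow> bool" where
  "common_pattern n m P k s \<longleftrightarrow>
     s \<in> sym_group k \<and> (\<forall>j\<in>{1..m}. contains_pattern n (P j) k s)"

(* The Max is over a nonempty set (the empty pattern, k = 0, always qualifies),
   which is finite whenever m > 0. *)
definition lcp_length :: "nat \<Rightarrow> nat \<Rightarrow> (nat \<Rightarrow> nat \<Rightarrow> nat) \<Rightarrow> nat" where
  "lcp_length n m P = Max {k. \<exists>s. common_pattern n m P k s}"

lemma common_pattern_lengths:
  assumes "m > 0"
  shows "finite {k. \<exists>s. common_pattern n m P k s}"
    and "0 \<in> {k. \<exists>s. common_pattern n m P k s}"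
proof -
  have "{k. \<exists>s. common_pattern n m P k s} \<subseteq> {..n}"
    using assms by (force simp: common_pattern_def contains_pattern_def)
  then show "finite {k. \<exists>s. common_pattern n m P k s}"
    by (rule finite_subset) simp
  have "common_pattern n m P 0 id"
    by (auto simp: common_pattern_def contains_pattern_def sym_group_def
        permutes_id strict_mono_on_def)
  then show "0 \<in> {k. \<exists>s. common_pattern n m P k s}"
    by blast
qed

(* The joint law of m independent uniformly random elements of S_n, indexed by {1..m}. *)
definition random_perms :: "nat \<Rightarrow> nat \<Rightarrow> (nat \<Rightarrow> nat \<Rightarrow> nat) pmf" where
  "random_perms n m = Pi_pmf {1..m} id (\<lambda>_. pmf_of_set (sym_group n))"

definition expected_lcp :: "nat \<Rightarrow> nat \<Rightarrow> real" where
  "expected_lcp n m =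
     measure_pmf.expectation (random_perms n m) (\<lambda>P. real (lcp_length n m P))"

end

theory Submission
  imports Defs "HOL-Real_Asymp.Real_Asymp"
begin

text \<open>
  Put \<open>k = \<lfloor>n\<^sup>\<gamma>\<rfloor>\<close> with \<open>\<gamma> = m / (2 m - 1)\<close>, and cut the diagram of every permutation into a
  \<open>k\<close> by \<open>k\<close> grid of cells, each about \<open>n / k\<close> wide and high. A cell holds a point of one given
  permutation with probability about \<open>n / k\<^sup>2\<close>, so it is occupied in all \<open>m\<close> permutations with
  probability about \<open>(n / k\<^sup>2)\<^sup>m\<close>; the exponent \<open>\<gamma>\<close> is the one for which this equals \<open>1 / k\<close>, that
  is, for which a row or column contains one commonly occupied cell on average. Commonly occupied
  cells in distinct rows and distinct columns give a common pattern, so it suffices to find a large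
  partial matching between columns and rows. The greedy one, which runs through the columns and
  takes in each of them a commonly occupied cell in a row not used before, is large enough.

  Two points make the analysis exact. First, the rows are not cut at fixed heights: every position
  of every permutation receives an independent uniform row label (\<open>avg_match_labels_le_expected_lcp\<close>
  shows that such labels can be coupled with uniformly random permutations so that lower labels go
  with lower values). The columns are then independent. Second, if \<open>V\<close> is the set of unused rows
  and \<open>p\<close> the probability that a column of one permutation hits a given row, then the next column
  offers nothing with probability at most \<open>b ^ card V\<close>, where \<open>b = 1 - p\<^sup>m\<close>, the value
  that independent hits would give (\<open>avg_power_card_common_labels_le\<close>). Hence the potential \<open>b powr (- card V) - 1\<close>
  shrinks in expectation at least by the factor \<open>b\<close> in each column, and after \<open>k\<close> columns its expectation
  is at most \<open>1 - b\<^sup>k\<close> (\<open>avg_match_potential_le\<close>).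

  As \<open>n\<close> grows, \<open>k * (- ln b)\<close> tends to \<open>1\<close>, so the expectation of \<open>exp (card V / k)\<close> is
  asymptotically at most \<open>2 - 1/e\<close>. Linearising the exponential at \<open>1/2\<close> bounds the expected fraction
  of unused rows by about \<open>exp (-1/2) * (2 - 1/e) - 1/2\<close>, which is close to \<open>0.49\<close> and leaves a
  matching of expected size more than \<open>k / 2\<close>.
\<close>

section \<open>Averages over finite sets\<close>

definition avg :: "'a set \<Rightarrow> ('a \<Rightarrow> real) \<Rightarrow> real" where
  "avg X f = (\<Sum>x\<in>X. f x) / real (card X)"

lemma avg_cong: "(\<And>x. x \<in> X \<Longrightarrow> f x = g x) \<Longrightarrow> avg X f = avg X g"
  by (simp add: avg_def)

lemma avg_mono: "(\<And>x. x \<in> X \<Longrightarrow> f x \<le> g x) \<Longrightarrow> avg X f \<le> avg X g"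
  by (auto simp: avg_def intro!: divide_right_mono sum_mono)

lemma avg_const: "finite X \<Longrightarrow> X \<noteq> {} \<Longrightarrow> avg X (\<lambda>_. a) = a"
  by (simp add: avg_def)

lemma avg_add: "avg X (\<lambda>x. f x + g x) = avg X f + avg X g"
  by (simp add: avg_def sum.distrib add_divide_distrib)

lemma avg_cmult: "avg X (\<lambda>x. a * f x) = a * avg X f"
  by (simp add: avg_def sum_distrib_left)

lemma avg_sum: "avg X (\<lambda>x. \<Sum>y\<in>Y. f x y) = (\<Sum>y\<in>Y. avg X (\<lambda>x. f x y))"
  by (simp add: avg_def sum_divide_distrib) (subst sum.swap, simp)

lemma avg_swap: "avg X (\<lambda>x. avg Y (\<lambda>y. f x y)) = avg Y (\<lambda>y. avg X (\<lambda>x. f x y))"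
  by (simp add: avg_def sum_divide_distrib divide_divide_eq_left mult.commute)
     (subst sum.swap, simp)

lemma avg_bij_betw:
  assumes "bij_betw h X Y"
  shows "avg X (\<lambda>x. f (h x)) = avg Y f"
  using assms sum.reindex_bij_betw[OF assms, of f]
  by (simp add: avg_def bij_betw_same_card)

lemma avg_funcset_Un:
  assumes "A \<inter> B = {}" "finite A" "finite B"
  shows "avg (A \<union> B \<rightarrow>\<^sub>E R) F =
         avg (A \<rightarrow>\<^sub>E R) (\<lambda>a. avg (B \<rightarrow>\<^sub>E R) (\<lambda>b. F (\<lambda>x. if x \<in> A then a x else b x)))"
proof -
  have "(\<Sum>a\<in>A \<rightarrow>\<^sub>E R. \<Sum>b\<in>B \<rightarrow>\<^sub>E R. F (\<lambda>x. if x \<in> A then a x else b x)) =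
        (\<Sum>(a, b)\<in>(A \<rightarrow>\<^sub>E R) \<times> (B \<rightarrow>\<^sub>E R). F (\<lambda>x. if x \<in> A then a x else b x))"
    by (rule sum.cartesian_product)
  also have "\<dots> = (\<Sum>f\<in>A \<union> B \<rightarrow>\<^sub>E R. F f)"
    using assms(1)
    by (intro sum.reindex_bij_witness
          [of _ "\<lambda>f. (restrict f A, restrict f B)" "\<lambda>(a, b) x. if x \<in> A then a x else b x"])
       (auto simp: PiE_iff extensional_def restrict_def fun_eq_iff split: if_splits)
  finally have "(\<Sum>f\<in>A \<union> B \<rightarrow>\<^sub>E R. F f) =
    (\<Sum>a\<in>A \<rightarrow>\<^sub>E R. \<Sum>b\<in>B \<rightarrow>\<^sub>E R. F (\<lambda>x. if x \<in> A then a x else b x))" by simp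
  then show ?thesis
    using assms
    by (simp add: avg_def card_funcsetE card_Un_disjoint power_add
        flip: sum_divide_distrib)
qed

section \<open>Rows hit by one column of the grid\<close>

text \<open>
  If the hits of the labels in \<open>A\<close> were independent, the two sides would be equal; the negative
  dependence between labels that compete for the same throws only helps. To see this, expand
  \<open>z\<close> to the power of the number of hits as the probability that a random subset \<open>T\<close> of \<open>A\<close>, which
  keeps each label with probability \<open>1 - z\<close>, is missed entirely. For fixed \<open>T\<close> that happens with
  probability \<open>(1 - card T / card R) ^ card B\<close>, and Bernoulli's inequality bounds
  \<open>1 - card T / card R\<close> by \<open>(1 - 1 / card R) ^ card T\<close>.
\<close>

lemma avg_power_card_hits_le:
  fixes z :: real
  assumes "finite B" "finite R" "R \<noteq> {}" "A \<subseteq> R" "0 \<le> z" "z \<le> 1"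
    and p: "p = 1 - (1 - 1 / real (card R)) ^ card B"
  shows "avg (B \<rightarrow>\<^sub>E R) (\<lambda>g. z ^ card (A \<inter> g ` B)) \<le> (1 - p + p * z) ^ card A"
proof -
  define N where "N = card R"
  have N: "N > 0" using assms by (simp add: N_def card_gt_0_iff)
  have finA: "finite A" using assms finite_subset by blast
  have expand: "z ^ card (A \<inter> g ` B) =
      (\<Sum>T\<in>Pow A. z ^ (card A - card T) * (1 - z) ^ card T * (if T \<inter> g ` B = {} then 1 else 0))" for g
  proof -
    have "z ^ card (A \<inter> g ` B) = (\<Prod>j\<in>A. if j \<in> g ` B then z else 1)"
      using finA by (simp add: prod.If_cases Int_def)
    also have "\<dots> = (\<Prod>j\<in>A. (1 - z) * (if j \<in> g ` B then 0 else 1) + z)"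
      by (intro prod.cong) auto
    also have "\<dots> = (\<Sum>T\<in>Pow A. (\<Prod>j\<in>T. (1 - z) * (if j \<in> g ` B then 0 else 1)) * (\<Prod>j\<in>A - T. z))"
      by (rule prod_add[OF finA])
    also have "\<dots> = (\<Sum>T\<in>Pow A. z ^ (card A - card T) * (1 - z) ^ card T * (if T \<inter> g ` B = {} then 1 else 0))"
    proof (rule sum.cong[OF refl])
      fix T assume "T \<in> Pow A"
      then have T: "T \<subseteq> A" "finite T" using finA finite_subset by auto
      have "(\<Prod>j\<in>T. (1 - z) * (if j \<in> g ` B then 0 else 1)) =
            (1 - z) ^ card T * (\<Prod>j\<in>T. if j \<in> g ` B then 0 else 1)"
        by (simp add: prod.distrib)
      also have "(\<Prod>j\<in>T. if j \<in> g ` B then 0 else 1 :: real) = (if T \<inter> g ` B = {} then 1 else 0)"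
      proof (cases "T \<inter> g ` B = {}")
        case True
        then show ?thesis by (subst prod.neutral) auto
      next
        case False
        then show ?thesis using T by (auto intro: prod_zero)
      qed
      finally show "(\<Prod>j\<in>T. (1 - z) * (if j \<in> g ` B then 0 else 1)) * (\<Prod>j\<in>A - T. z) =
         z ^ (card A - card T) * (1 - z) ^ card T * (if T \<inter> g ` B = {} then 1 else 0)"
        using T by (simp add: card_Diff_subset)
    qed
    finally show ?thesis .
  qed
  have miss: "avg (B \<rightarrow>\<^sub>E R) (\<lambda>g. if T \<inter> g ` B = {} then 1 else 0) \<le> (1 - p) ^ card T"
    if T: "T \<subseteq> A" for T
  proof -
    have TR: "T \<subseteq> R" "finite T" using T assms finA finite_subset by auto
    then have cT: "card T \<le> N" using assms card_mono by (auto simp: N_def)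
    have "(\<Sum>g\<in>B \<rightarrow>\<^sub>E R. if T \<inter> g ` B = {} then 1 else 0 :: real) = card {g \<in> B \<rightarrow>\<^sub>E R. T \<inter> g ` B = {}}"
      using assms by (subst sum.If_cases) (auto simp: finite_PiE Int_def)
    also have "{g \<in> B \<rightarrow>\<^sub>E R. T \<inter> g ` B = {}} = B \<rightarrow>\<^sub>E (R - T)"
      by (auto simp: PiE_iff extensional_def)
    also have "real (card \<dots>) = real (N - card T) ^ card B"
      using assms TR by (simp add: card_funcsetE card_Diff_subset N_def)
    finally have "avg (B \<rightarrow>\<^sub>E R) (\<lambda>g. if T \<inter> g ` B = {} then 1 else 0) = (1 - card T / N) ^ card B"
      using assms N cT
      by (simp add: avg_def card_funcsetE N_def of_nat_diff diff_divide_distrib flip: power_divide)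
    also have "\<dots> \<le> ((1 - 1 / N) ^ card T) ^ card B"
    proof (rule power_mono)
      have "1 + real (card T) * (- 1 / N) \<le> (1 + (- 1 / N)) ^ card T"
        using N by (intro Bernoulli_inequality) (auto simp: field_simps)
      then show "1 - card T / N \<le> (1 - 1 / N) ^ card T" by simp
      show "0 \<le> 1 - card T / N" using cT N by simp
    qed
    also have "\<dots> = (1 - p) ^ card T"
      by (simp add: p N_def flip: power_mult) (simp add: mult.commute)
    finally show ?thesis .
  qed
  have "avg (B \<rightarrow>\<^sub>E R) (\<lambda>g. z ^ card (A \<inter> g ` B)) =
    (\<Sum>T\<in>Pow A. z ^ (card A - card T) * (1 - z) ^ card T *
       avg (B \<rightarrow>\<^sub>E R) (\<lambda>g. if T \<inter> g ` B = {} then 1 else 0))"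
    unfolding expand avg_sum avg_cmult ..
  also have "\<dots> \<le> (\<Sum>T\<in>Pow A. z ^ (card A - card T) * (1 - z) ^ card T * (1 - p) ^ card T)"
    using assms by (intro sum_mono mult_left_mono miss) auto
  also have "\<dots> = (\<Sum>T\<in>Pow A. (\<Prod>j\<in>T. (1 - z) * (1 - p)) * (\<Prod>j\<in>A - T. z))"
    by (intro sum.cong)
       (auto simp: power_mult_distrib card_Diff_subset finite_subset[OF _ finA])
  also have "\<dots> = (\<Prod>j\<in>A. (1 - z) * (1 - p) + z)"
    by (rule prod_add[OF finA, symmetric])
  also have "\<dots> = (1 - p + p * z) ^ card A"
    by (simp add: algebra_simps)
  finally show ?thesis .
qed

lemma hit_probability_bounds:
  assumes "finite R" "R \<noteq> {}"
  shows "0 \<le> 1 - (1 - 1 / real (card R)) ^ s" "1 - (1 - 1 / real (card R)) ^ s \<le> 1"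
proof -
  have "card R \<ge> 1" using assms by (simp add: card_gt_0_iff Suc_le_eq)
  then have "0 \<le> 1 - 1 / real (card R)" "1 - 1 / real (card R) \<le> 1" by auto
  then show "0 \<le> 1 - (1 - 1 / real (card R)) ^ s" "1 - (1 - 1 / real (card R)) ^ s \<le> 1"
    by (auto intro: power_le_one)
qed

text \<open>
  \<open>J\<close> indexes the permutations and \<open>B\<close> is the set of positions of a column.
\<close>

definition common_labels :: "'i set \<Rightarrow> 'q set \<Rightarrow> ('i \<times> 'q \<Rightarrow> 'r) \<Rightarrow> 'r set" where
  "common_labels J B c = {j. \<forall>i\<in>J. \<exists>q\<in>B. c (i, q) = j}"

text \<open>
  Averaging over one more permutation replaces \<open>z\<close> by \<open>1 - p + p * z\<close>, and iterating this
  affine map, which fixes \<open>1\<close>, gives \<open>1 - p ^ card J * (1 - z)\<close>. This is why the generating function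
  is carried along even though the greedy matching only calls for \<open>z = 0\<close>, the probability that
  no label of \<open>V\<close> is common.
\<close>

lemma avg_power_card_common_labels_le:
  fixes z :: real
  assumes "finite J" "finite B" "finite R" "R \<noteq> {}" "V \<subseteq> R" "0 \<le> z" "z \<le> 1"
    and p: "p = 1 - (1 - 1 / real (card R)) ^ card B"
  shows "avg (J \<times> B \<rightarrow>\<^sub>E R) (\<lambda>c. z ^ card (V \<inter> common_labels J B c)) \<le>
         (1 - p ^ card J * (1 - z)) ^ card V"
  using assms(1,6,7)
proof (induction J arbitrary: z rule: finite_induct)
  case empty
  then show ?case by (simp add: common_labels_def avg_def)
next
  case (insert i J)
  define D where "D = {i} \<times> B"
  have p01: "0 \<le> p" "p \<le> 1"
    using hit_probability_bounds[of R "card B"] assms by (auto simp: p)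
  have cB: "card D = card B" by (simp add: D_def card_cartesian_product)
  have split: "insert i J \<times> B = (J \<times> B) \<union> D" "(J \<times> B) \<inter> D = {}"
    using insert by (auto simp: D_def)
  have "avg (insert i J \<times> B \<rightarrow>\<^sub>E R) (\<lambda>c. z ^ card (V \<inter> common_labels (insert i J) B c)) =
        avg (J \<times> B \<rightarrow>\<^sub>E R) (\<lambda>a. avg (D \<rightarrow>\<^sub>E R) (\<lambda>g. z ^ card (V \<inter> common_labels (insert i J) B
            (\<lambda>x. if x \<in> J \<times> B then a x else g x))))"
    unfolding split(1) using insert assms by (intro avg_funcset_Un split(2)) (auto simp: D_def)
  also have "\<dots> = avg (J \<times> B \<rightarrow>\<^sub>E R)
       (\<lambda>a. avg (D \<rightarrow>\<^sub>E R) (\<lambda>g. z ^ card ((V \<inter> common_labels J B a) \<inter> g ` D)))"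
  proof (intro avg_cong arg_cong[where f = "\<lambda>X. z ^ card X"])
    fix a g
    show "V \<inter> common_labels (insert i J) B (\<lambda>x. if x \<in> J \<times> B then a x else g x) =
          V \<inter> common_labels J B a \<inter> g ` D"
      using insert by (auto simp: common_labels_def D_def)
  qed
  also have "\<dots> \<le> avg (J \<times> B \<rightarrow>\<^sub>E R) (\<lambda>a. (1 - p + p * z) ^ card (V \<inter> common_labels J B a))"
  proof (intro avg_mono avg_power_card_hits_le)
    show "p = 1 - (1 - 1 / real (card R)) ^ card D" by (simp only: p cB)
  qed (use assms insert.prems in \<open>auto simp: D_def\<close>)
  also have "\<dots> \<le> (1 - p ^ card J * (1 - (1 - p + p * z))) ^ card V"
    using p01 insert.prems
    by (intro insert.IH) (auto simp: mult_left_le)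
  also have "1 - p ^ card J * (1 - (1 - p + p * z)) = 1 - p ^ card (insert i J) * (1 - z)"
    using insert by (simp add: algebra_simps)
  finally show ?case .
qed

section \<open>The greedy matching and its potential\<close>

text \<open>
  The rows matched to the first \<open>t\<close> columns, where \<open>S u\<close> is the set of rows that column \<open>u\<close>
  offers. Taking the least free row is an arbitrary choice.
\<close>

fun greedy_match :: "(nat \<Rightarrow> 'r::wellorder set) \<Rightarrow> nat \<Rightarrow> 'r set" where
  "greedy_match S 0 = {}"
| "greedy_match S (Suc t) = greedy_match S t \<union>
     (if S t \<subseteq> greedy_match S t then {} else {LEAST j. j \<in> S t - greedy_match S t})"

lemma greedy_match_cong:
  "(\<And>u. u < t \<Longrightarrow> S u = S' u) \<Longrightarrow> greedy_match S t = greedy_match S' t"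
  by (induction t) auto

lemma greedy_match_Suc_cases:
  obtains "S t \<subseteq> greedy_match S t" "greedy_match S (Suc t) = greedy_match S t"
  | j where "j \<in> S t" "j \<notin> greedy_match S t" "greedy_match S (Suc t) = insert j (greedy_match S t)"
proof (cases "S t \<subseteq> greedy_match S t")
  case True
  then show ?thesis using that by simp
next
  case False
  define j where "j = (LEAST j. j \<in> S t - greedy_match S t)"
  from False have "\<exists>j. j \<in> S t - greedy_match S t" by blast
  then have "j \<in> S t - greedy_match S t" unfolding j_def by (rule LeastI_ex)
  moreover have "greedy_match S (Suc t) = insert j (greedy_match S t)"
    using False by (simp add: j_def)
  ultimately show ?thesis using that(2) by blast
qed

lemma greedy_match_subset: "(\<And>u. u < t \<Longrightarrow> S u \<subseteq> R) \<Longrightarrow> greedy_match S t \<subseteq> R"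
proof (induction t)
  case (Suc t)
  then have "greedy_match S t \<subseteq> R" "S t \<subseteq> R" by auto
  then show ?case by (cases rule: greedy_match_Suc_cases[of S t]) auto
qed simp

lemma greedy_match_transversal:
  "\<exists>T f. T \<subseteq> {..<t} \<and> inj_on f T \<and> f ` T = greedy_match S t \<and> (\<forall>u\<in>T. f u \<in> S u)"
proof (induction t)
  case (Suc t)
  then obtain T f where T: "T \<subseteq> {..<t}" "inj_on f T" "f ` T = greedy_match S t" "\<forall>u\<in>T. f u \<in> S u"
    by blast
  show ?case
  proof (cases rule: greedy_match_Suc_cases[of S t])
    case 1
    then show ?thesis using T by (intro exI[of _ T] exI[of _ f]) auto
  next
    case (2 j)
    have "t \<notin> T" using T by auto
    moreover have "f(t := j) ` T = greedy_match S t"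
      using T(3) \<open>t \<notin> T\<close> by auto
    moreover have "inj_on (f(t := j)) T"
      using T(2) \<open>t \<notin> T\<close> unfolding inj_on_def by auto
    ultimately have "f(t := j) ` insert t T = insert j (greedy_match S t)"
      "inj_on (f(t := j)) (insert t T)"
      using 2(2) \<open>t \<notin> T\<close> by auto
    moreover have "\<forall>u\<in>insert t T. (f(t := j)) u \<in> S u"
      using T(4) 2(1) \<open>t \<notin> T\<close> by auto
    moreover have "insert t T \<subseteq> {..<Suc t}" using T(1) by auto
    ultimately show ?thesis unfolding 2(3) by blast
  qed
qed auto

text \<open>
  The exponent of \<open>0\<close> is zero exactly if the column offers no free row, so the last factor
  is \<open>1\<close> in that case and \<open>b\<close> otherwise.
\<close>

lemma greedy_match_potential_step:
  fixes b :: real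
  assumes "finite R" "S t \<subseteq> R" "greedy_match S t \<subseteq> R" "b > 0"
  defines "V \<equiv> R - greedy_match S t"
  shows "(1 / b) ^ card (R - greedy_match S (Suc t)) =
         (1 / b) ^ card V * (b + (1 - b) * 0 ^ card (V \<inter> S t))"
proof -
  have finV: "finite V" using assms by simp
  show ?thesis
  proof (cases rule: greedy_match_Suc_cases[of S t])
    case 1
    then have "V \<inter> S t = {}" by (auto simp: V_def)
    then show ?thesis using 1 by (simp add: V_def)
  next
    case (2 j)
    then have j: "j \<in> V \<inter> S t" using assms by (auto simp: V_def)
    then have "card (V \<inter> S t) \<noteq> 0" using finV by auto
    have "R - greedy_match S (Suc t) = V - {j}" using 2 by (auto simp: V_def)
    moreover have "card V = Suc (card (V - {j}))" using j finV by (metis IntD1 card.remove)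
    ultimately show ?thesis using assms \<open>card (V \<inter> S t) \<noteq> 0\<close> by (simp add: power_0_left)
  qed
qed

definition match_labels :: "'r set \<Rightarrow> 'i set \<Rightarrow> (nat \<Rightarrow> 'q set) \<Rightarrow> ('i \<times> 'q \<Rightarrow> 'r::wellorder) \<Rightarrow> nat \<Rightarrow> 'r set" where
  "match_labels R J B c = greedy_match (\<lambda>u. R \<inter> common_labels J (B u) c)"

lemma match_labels_subset: "match_labels R J B c t \<subseteq> R"
  unfolding match_labels_def by (intro greedy_match_subset) auto

lemma match_labels_cong:
  assumes "\<And>i q u. i \<in> J \<Longrightarrow> u < t \<Longrightarrow> q \<in> B u \<Longrightarrow> c (i, q) = c' (i, q)"
  shows "match_labels R J B c t = match_labels R J B c' t"
  unfolding match_labels_def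
  using assms by (intro greedy_match_cong) (auto simp: common_labels_def)

text \<open>
  With \<open>v\<close> free rows the next column fails with probability at most \<open>b ^ v\<close>, so the
  expected new value of \<open>(1 / b) ^ v\<close> is at most
  \<open>(1 / b) ^ v * (b + (1 - b) * b ^ v) = b * (1 / b) ^ v + (1 - b)\<close>. The base \<open>1 / b\<close> is the one
  for which this recursion is affine in the potential, so that expectations can be iterated.
\<close>

lemma avg_match_potential_le:
  fixes b :: real and J :: "'i set" and B :: "nat \<Rightarrow> 'q set" and R :: "'r::wellorder set"
  assumes "finite J" "\<And>u. finite (B u)" "\<And>u. card (B u) = s" "disjoint_family B"
    and "finite R" "R \<noteq> {}" "b > 0"
    and b: "b = 1 - (1 - (1 - 1 / real (card R)) ^ s) ^ card J"
  shows "avg (J \<times> (\<Union>u<t. B u) \<rightarrow>\<^sub>E R) (\<lambda>c. (1 / b) ^ card (R - match_labels R J B c t)) \<le>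
         1 + b ^ t * ((1 / b) ^ card R - 1)"
proof (induction t)
  case 0
  then show ?case by (simp add: match_labels_def avg_def)
next
  case (Suc t)
  define I where "I = J \<times> (\<Union>u<t. B u)"
  define D where "D = J \<times> B t"
  have p1: "(1 - 1 / real (card R)) ^ s \<le> 1"
    using hit_probability_bounds[of R s] assms by auto
  then have b1: "b \<le> 1" using b by simp
  have fin: "finite I" "finite D" using assms by (auto simp: I_def D_def)
  have ne: "finite (D \<rightarrow>\<^sub>E R)" "D \<rightarrow>\<^sub>E R \<noteq> {}" "finite (I \<rightarrow>\<^sub>E R)" "I \<rightarrow>\<^sub>E R \<noteq> {}"
    using fin assms by (auto simp: finite_PiE PiE_eq_empty_iff)
  have "B u \<inter> B t = {}" if "u < t" for u
    using disjoint_family_onD[OF assms(4), of u t] that by simp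
  then have ID: "I \<inter> D = {}"
    unfolding I_def D_def by blast
  have eq: "J \<times> (\<Union>u<Suc t. B u) = I \<union> D"
    by (auto simp: I_def D_def less_Suc_eq)
  let ?M = "\<lambda>c t. match_labels R J B c t"
  have "avg (J \<times> (\<Union>u<Suc t. B u) \<rightarrow>\<^sub>E R) (\<lambda>c. (1 / b) ^ card (R - ?M c (Suc t))) =
    avg (I \<rightarrow>\<^sub>E R) (\<lambda>a. avg (D \<rightarrow>\<^sub>E R) (\<lambda>g. (1 / b) ^ card (R - ?M (\<lambda>x. if x \<in> I then a x else g x) (Suc t))))"
    unfolding eq by (rule avg_funcset_Un[OF ID fin])
  also have "\<dots> = avg (I \<rightarrow>\<^sub>E R) (\<lambda>a. avg (D \<rightarrow>\<^sub>E R) (\<lambda>g.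
      (1 / b) ^ card (R - ?M a t) * (b + (1 - b) * 0 ^ card ((R - ?M a t) \<inter> common_labels J (B t) g))))"
  proof (intro avg_cong)
    fix a g :: "'i \<times> 'q \<Rightarrow> 'r"
    let ?c = "\<lambda>x. if x \<in> I then a x else g x"
    \<comment> \<open>The past depends on the old columns only, the offer of column \<open>t\<close> on the new one only.\<close>
    have M: "?M ?c t = ?M a t"
      by (rule match_labels_cong) (auto simp: I_def)
    have C: "common_labels J (B t) ?c = common_labels J (B t) g"
      using ID by (fastforce simp: common_labels_def I_def D_def)
    have "(1 / b) ^ card (R - ?M ?c (Suc t)) = (1 / b) ^ card (R - ?M ?c t) *
       (b + (1 - b) * 0 ^ card ((R - ?M ?c t) \<inter> (R \<inter> common_labels J (B t) ?c)))"
      unfolding match_labels_def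
      using assms match_labels_subset[of R J B ?c t, unfolded match_labels_def]
      by (intro greedy_match_potential_step) auto
    also have "(R - ?M ?c t) \<inter> (R \<inter> common_labels J (B t) ?c) =
               (R - ?M a t) \<inter> common_labels J (B t) g"
      unfolding M C by auto
    finally show "(1 / b) ^ card (R - ?M ?c (Suc t)) =
       (1 / b) ^ card (R - ?M a t) * (b + (1 - b) * 0 ^ card ((R - ?M a t) \<inter> common_labels J (B t) g))"
      unfolding M .
  qed
  also have "\<dots> = avg (I \<rightarrow>\<^sub>E R) (\<lambda>a. (1 / b) ^ card (R - ?M a t) *
      (b + (1 - b) * avg (D \<rightarrow>\<^sub>E R) (\<lambda>g. 0 ^ card ((R - ?M a t) \<inter> common_labels J (B t) g))))"
    by (simp only: avg_cmult avg_add avg_const[OF ne(1,2)])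
  also have "\<dots> \<le> avg (I \<rightarrow>\<^sub>E R) (\<lambda>a. (1 / b) ^ card (R - ?M a t) *
      (b + (1 - b) * b ^ card (R - ?M a t)))"
  proof (intro avg_mono mult_left_mono add_left_mono)
    fix a
    have "avg (D \<rightarrow>\<^sub>E R) (\<lambda>g. 0 ^ card ((R - ?M a t) \<inter> common_labels J (B t) g)) \<le>
       (1 - (1 - (1 - 1 / real (card R)) ^ s) ^ card J * (1 - 0)) ^ card (R - ?M a t)"
      unfolding D_def using assms by (intro avg_power_card_common_labels_le) auto
    then show "avg (D \<rightarrow>\<^sub>E R) (\<lambda>g. 0 ^ card ((R - ?M a t) \<inter> common_labels J (B t) g)) \<le>
       b ^ card (R - ?M a t)" by (simp add: b)
  qed (use b1 \<open>b > 0\<close> in auto)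
  also have "\<dots> = avg (I \<rightarrow>\<^sub>E R) (\<lambda>a. b * (1 / b) ^ card (R - ?M a t) + (1 - b))"
    using \<open>b > 0\<close> by (intro avg_cong) (simp add: field_simps)
  also have "\<dots> = b * avg (I \<rightarrow>\<^sub>E R) (\<lambda>a. (1 / b) ^ card (R - ?M a t)) + (1 - b)"
    by (simp only: avg_cmult avg_add avg_const[OF ne(3,4)])
  also have "\<dots> \<le> b * (1 + b ^ t * ((1 / b) ^ card R - 1)) + (1 - b)"
    using Suc \<open>b > 0\<close> by (intro add_right_mono mult_left_mono) (auto simp: I_def)
  also have "\<dots> = 1 + b ^ Suc t * ((1 / b) ^ card R - 1)"
    by (simp add: algebra_simps)
  finally show ?case .
qed

section \<open>From a matching to a common pattern\<close>

text \<open>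
  The permutation sends \<open>a\<close> to the rank of \<open>g a\<close>. It turns the rows of a matching into the
  pattern they form, and it also yields sorting permutations.
\<close>

lemma standardization:
  fixes g :: "nat \<Rightarrow> 'a::linorder"
  assumes inj: "inj_on g {1..l}"
  obtains s where "s permutes {1..l}"
    "\<And>a b. a \<in> {1..l} \<Longrightarrow> b \<in> {1..l} \<Longrightarrow> s a < s b \<longleftrightarrow> g a < g b"
proof -
  define s where "s a = (if a \<in> {1..l} then card {b \<in> {1..l}. g b \<le> g a} else a)" for a
  have less: "s a < s b" if "a \<in> {1..l}" "b \<in> {1..l}" "g a < g b" for a b
  proof -
    have "{x \<in> {1..l}. g x \<le> g a} \<subset> {x \<in> {1..l}. g x \<le> g b}"
    proof (rule psubsetI)
      show "{x \<in> {1..l}. g x \<le> g a} \<noteq> {x \<in> {1..l}. g x \<le> g b}"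
        using that by (metis (mono_tags, lifting) leD mem_Collect_eq order_refl)
    qed (use that in auto)
    then have "card {x \<in> {1..l}. g x \<le> g a} < card {x \<in> {1..l}. g x \<le> g b}"
      by (intro psubset_card_mono) simp_all
    then show ?thesis using that by (simp only: s_def if_True)
  qed
  have iff: "s a < s b \<longleftrightarrow> g a < g b" if "a \<in> {1..l}" "b \<in> {1..l}" for a b
    using less[OF that] less[OF that(2) that(1)] inj_onD[OF inj _ that]
    by (metis less_asym linorder_less_linear order_less_irrefl)
  have inj_s: "inj_on s {1..l}"
    using iff by (intro inj_onI) (metis inj inj_onD linorder_less_linear order_less_irrefl)
  have "s a \<in> {1..l}" if "a \<in> {1..l}" for a
  proof -
    define C where "C = {b \<in> {1..l}. g b \<le> g a}"
    have "C \<noteq> {}" "C \<subseteq> {1..l}" using that by (auto simp: C_def)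
    then have "card C \<noteq> 0" "card C \<le> card {1..l}"
      using finite_subset[of C "{1..l}"] card_mono[of "{1..l}" C] by auto
    moreover have "s a = card C" using that by (simp only: s_def C_def if_True)
    ultimately show ?thesis by simp
  qed
  then have "s ` {1..l} = {1..l}"
    by (intro endo_inj_surj inj_s) auto
  then have "s permutes {1..l}"
    using inj_s by (intro bij_imp_permutes) (auto simp: bij_betw_def s_def)
  then show ?thesis using iff that by blast
qed

text \<open>
  In each permutation and each matched column, pick a position that carries the label matched to
  that column. The columns order the positions and the labels order the values, in the same way
  for all permutations.
\<close>

lemma card_match_labels_le_lcp_length:
  fixes c :: "nat \<times> nat \<Rightarrow> nat"
  assumes "m > 0"
    and compat: "\<And>i a b. i \<in> {1..m} \<Longrightarrow> a \<in> {1..n} \<Longrightarrow> b \<in> {1..n} \<Longrightarrow>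
                   c (i, a) < c (i, b) \<Longrightarrow> P i a < P i b"
    and B: "\<And>u. u < k \<Longrightarrow> B u \<subseteq> {1..n}"
    and B_less: "\<And>u v x y. u < v \<Longrightarrow> v < k \<Longrightarrow> x \<in> B u \<Longrightarrow> y \<in> B v \<Longrightarrow> x < y"
  shows "card (match_labels R {1..m} B c k) \<le> lcp_length n m P"
proof -
  obtain T f where T: "T \<subseteq> {..<k}" "inj_on f T" "f ` T = match_labels R {1..m} B c k"
      "\<forall>u\<in>T. f u \<in> R \<inter> common_labels {1..m} (B u) c"
    using greedy_match_transversal[of k "\<lambda>u. R \<inter> common_labels {1..m} (B u) c"]
    unfolding match_labels_def by blast
  define l where "l = card T"
  have l: "l = card (match_labels R {1..m} B c k)"
    using T(2,3) by (metis card_image l_def)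
  have "finite T" using T(1) finite_subset by blast
  then obtain h where h: "bij_betw h {..<l} T" "strict_mono_on {..<l} h"
    unfolding l_def by (rule ex_bij_betw_strict_mono_card)
  \<comment> \<open>Patterns are indexed from \<open>1\<close>, the enumeration \<open>h\<close> of the matched columns from \<open>0\<close>.\<close>
  define e where "e a = h (a - 1)" for a
  have eT: "e a \<in> T" if "a \<in> {1..l}" for a
    using that bij_betw_apply[OF h(1), of "a - 1"] by (auto simp: e_def)
  have e_less: "e a < e b" if "a \<in> {1..l}" "b \<in> {1..l}" "a < b" for a b
    using that strict_mono_onD[OF h(2), of "a - 1" "b - 1"] by (auto simp: e_def)
  have e_neq: "e a \<noteq> e b" if "a \<in> {1..l}" "b \<in> {1..l}" "a \<noteq> b" for a b
    using e_less that by (metis linorder_less_linear order_less_irrefl)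
  have inj: "inj_on (\<lambda>a. f (e a)) {1..l}"
  proof (rule inj_onI, rule ccontr)
    fix a b assume ab: "a \<in> {1..l}" "b \<in> {1..l}" "f (e a) = f (e b)" "a \<noteq> b"
    show False using e_neq[OF ab(1,2,4)] inj_onD[OF T(2) ab(3) eT eT] ab(1,2) by simp
  qed
  obtain s where s: "s permutes {1..l}"
      "\<And>a b. a \<in> {1..l} \<Longrightarrow> b \<in> {1..l} \<Longrightarrow> s a < s b \<longleftrightarrow> f (e a) < f (e b)"
    using standardization[OF inj] by blast
  have "contains_pattern n (P i) l s" if i: "i \<in> {1..m}" for i
  proof -
    have "\<forall>u\<in>T. \<exists>q\<in>B u. c (i, q) = f u"
      using T(4) i by (auto simp: common_labels_def)
    then obtain pos where pos: "\<And>u. u \<in> T \<Longrightarrow> pos u \<in> B u" "\<And>u. u \<in> T \<Longrightarrow> c (i, pos u) = f u"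
      by metis
    define x where "x a = pos (e a)" for a
    have xn: "x a \<in> {1..n}" if "a \<in> {1..l}" for a
      using pos(1)[OF eT[OF that]] B[of "e a"] eT[OF that] T(1) unfolding x_def by blast
    have x_mono: "strict_mono_on {1..l} x"
    proof (rule strict_mono_onI)
      fix a b assume ab: "a \<in> {1..l}" "b \<in> {1..l}" "a < b"
      then show "x a < x b"
        using B_less[OF e_less[OF ab]] pos(1) eT T(1) unfolding x_def by blast
    qed
    have "inj_on x {1..l}"
      using x_mono by (rule strict_mono_on_imp_inj_on)
    then have "card {1..l} \<le> card {1..n}"
      using xn by (intro card_inj_on_le) auto
    then have "l \<le> n" by simp
    moreover have "P i (x a) < P i (x b) \<longleftrightarrow> s a < s b" if "a \<in> {1..l}" "b \<in> {1..l}" for a b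
    proof -
      have cx: "c (i, x a) = f (e a)" if "a \<in> {1..l}" for a
        using pos(2)[OF eT[OF that]] by (simp add: x_def)
      have 1: "P i (x a) < P i (x b)" if "a \<in> {1..l}" "b \<in> {1..l}" "f (e a) < f (e b)" for a b
        using compat[OF i xn xn, of a b] that cx by simp
      have "a = b \<or> f (e a) < f (e b) \<or> f (e b) < f (e a)"
        using inj that by (metis inj_onD linorder_less_linear)
      then show ?thesis
        using 1[of a b] 1[of b a] s(2) that by fastforce
    qed
    ultimately show ?thesis
      using xn x_mono unfolding contains_pattern_def by blast
  qed
  then have "common_pattern n m P l s"
    using s(1) by (simp add: common_pattern_def sym_group_def)
  then show ?thesis
    unfolding lcp_length_def l[symmetric]
    using common_pattern_lengths(1)[OF \<open>m > 0\<close>] by (intro Max_ge) blast+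
qed

section \<open>Coupling random permutations with independent labels\<close>

lemma expected_lcp_eq_avg:
  "expected_lcp n m =
   avg (PiE_dflt {1..m} id (\<lambda>_. sym_group n)) (\<lambda>P. real (lcp_length n m P))"
proof -
  have S: "finite (sym_group n)" "sym_group n \<noteq> {}"
    using permutes_id[of "{1..n}"] finite_permutations[of "{1..n}"] unfolding sym_group_def by blast+
  let ?X = "PiE_dflt {1..m} (id :: nat \<Rightarrow> nat) (\<lambda>_. sym_group n)"
  have "finite ?X" using S by (intro finite_PiE_dflt) auto
  moreover have "(\<lambda>_. id) \<in> ?X"
    by (auto simp: PiE_dflt_def sym_group_def permutes_id)
  ultimately show ?thesis
    unfolding expected_lcp_def random_perms_def
    using S by (subst Pi_pmf_of_set) (auto simp: integral_pmf_of_set avg_def)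
qed

lemma bij_betw_compose_perms:
  assumes "\<And>i. i \<in> A \<Longrightarrow> s i permutes S"
  shows "bij_betw (\<lambda>P i. if i \<in> A then s i \<circ> P i else id)
           (PiE_dflt A id (\<lambda>_. {p. p permutes S})) (PiE_dflt A id (\<lambda>_. {p. p permutes S}))"
proof (rule bij_betw_byWitness[where f' = "\<lambda>P i. if i \<in> A then inv (s i) \<circ> P i else id"])
  have inv: "inv (s i) permutes S" if "i \<in> A" for i using assms[OF that] by (rule permutes_inv)
  have i1: "inv (s i) (s i x) = x" "s i (inv (s i) x) = x" if "i \<in> A" for i x
    using permutes_inverses[OF assms[OF that]] by auto
  show "\<forall>P\<in>PiE_dflt A id (\<lambda>_. {p. p permutes S}).
     (\<lambda>i. if i \<in> A then inv (s i) \<circ> (if i \<in> A then s i \<circ> P i else id) else id) = P"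
    using i1 by (auto simp: PiE_dflt_def fun_eq_iff)
  show "\<forall>P\<in>PiE_dflt A id (\<lambda>_. {p. p permutes S}).
     (\<lambda>i. if i \<in> A then s i \<circ> (if i \<in> A then inv (s i) \<circ> P i else id) else id) = P"
    using i1 by (auto simp: PiE_dflt_def fun_eq_iff)
qed (auto simp: PiE_dflt_def assms permutes_inv intro!: permutes_compose)

lemma bij_betw_relabel_positions:
  assumes "\<And>i. i \<in> A \<Longrightarrow> p i permutes S"
  shows "bij_betw (\<lambda>c. restrict (\<lambda>(i, q). c (i, p i q)) (A \<times> S)) (A \<times> S \<rightarrow>\<^sub>E R) (A \<times> S \<rightarrow>\<^sub>E R)"
proof (rule bij_betw_byWitness[where f' = "\<lambda>c. restrict (\<lambda>(i, q). c (i, inv (p i) q)) (A \<times> S)"])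
  have i1: "inv (p i) (p i x) = x" "p i (inv (p i) x) = x" if "i \<in> A" for i x
    using permutes_inverses[OF assms[OF that]] by auto
  have i2: "p i x \<in> S \<longleftrightarrow> x \<in> S" "inv (p i) x \<in> S \<longleftrightarrow> x \<in> S" if "i \<in> A" for i x
    using permutes_in_image[OF assms[OF that]] permutes_in_image[OF permutes_inv[OF assms[OF that]]]
    by auto
  show "\<forall>c\<in>A \<times> S \<rightarrow>\<^sub>E R. restrict (\<lambda>(i, q). restrict (\<lambda>(i, q). c (i, p i q)) (A \<times> S) (i, inv (p i) q)) (A \<times> S) = c"
    using i1 i2 by (auto simp: fun_eq_iff PiE_iff extensional_def)
  show "\<forall>c\<in>A \<times> S \<rightarrow>\<^sub>E R. restrict (\<lambda>(i, q). restrict (\<lambda>(i, q). c (i, inv (p i) q)) (A \<times> S) (i, p i q)) (A \<times> S) = c"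
    using i1 i2 by (auto simp: fun_eq_iff PiE_iff extensional_def)
  show "(\<lambda>c. restrict (\<lambda>(i, q). c (i, p i q)) (A \<times> S)) ` (A \<times> S \<rightarrow>\<^sub>E R) \<subseteq> A \<times> S \<rightarrow>\<^sub>E R"
    using i2 by (auto simp: PiE_iff split: if_splits)
  show "(\<lambda>c. restrict (\<lambda>(i, q). c (i, inv (p i) q)) (A \<times> S)) ` (A \<times> S \<rightarrow>\<^sub>E R) \<subseteq> A \<times> S \<rightarrow>\<^sub>E R"
    using i2 by (auto simp: PiE_iff split: if_splits)
qed

text \<open>
  Breaking ties between equal labels by position makes the labels injective, so that they can be
  standardized.
\<close>

lemma sorting_permutation:
  fixes c :: "nat \<Rightarrow> nat"
  obtains s where "s permutes {1..n}"
    "\<And>x y. x \<in> {1..n} \<Longrightarrow> y \<in> {1..n} \<Longrightarrow> c (inv s x) < c (inv s y) \<Longrightarrow> x < y"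
proof -
  \<comment> \<open>On \<open>{1..n}\<close> this key orders the pairs \<open>(c a, a)\<close> lexicographically.\<close>
  define g where "g a = c a * Suc n + a" for a
  have g_less: "g a < g b" if "a \<in> {1..n}" "c a < c b" for a b
  proof -
    have "g a < Suc (c a) * Suc n" using that by (simp add: g_def)
    also have "\<dots> \<le> c b * Suc n" using that by (intro mult_right_mono) auto
    finally show ?thesis by (simp add: g_def)
  qed
  have "inj_on g {1..n}"
  proof (rule inj_onI)
    fix a b assume ab: "a \<in> {1..n}" "b \<in> {1..n}" "g a = g b"
    then have "c a = c b" using g_less[of a b] g_less[of b a] by (metis linorder_less_linear order_less_irrefl)
    then show "a = b" using ab(3) by (simp add: g_def)
  qed
  then obtain s where s: "s permutes {1..n}"
      "\<And>a b. a \<in> {1..n} \<Longrightarrow> b \<in> {1..n} \<Longrightarrow> s a < s b \<longleftrightarrow> g a < g b"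
    using standardization by blast
  have "x < y" if "x \<in> {1..n}" "y \<in> {1..n}" "c (inv s x) < c (inv s y)" for x y
  proof -
    have "inv s x \<in> {1..n}" "inv s y \<in> {1..n}"
      using that permutes_in_image[OF permutes_inv[OF s(1)]] by auto
    then show ?thesis
      using g_less that(3) s(2) permutes_inverses(1)[OF s(1)] by metis
  qed
  then show ?thesis using that s(1) by blast
qed

text \<open>
  The coupling: draw labels \<open>c\<close> and permutations \<open>P\<close> independently, sort each sequence of
  labels \<open>c (i, _)\<close> into a nondecreasing function \<open>h i\<close>, and give position \<open>q\<close> of permutation \<open>i\<close> the label
  \<open>h i (P i q)\<close>. These labels are weakly increasing in the values, so a matching
  yields a common pattern. They are also uniform and independent: for fixed \<open>c\<close>, replacing \<open>h i\<close>
  by \<open>c (i, _)\<close> amounts to composing \<open>P i\<close> with a fixed permutation, and for fixed \<open>P\<close>, the labels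
  \<open>c (i, P i q)\<close> are a rearrangement of the labels \<open>c\<close>.
\<close>

lemma avg_match_labels_le_expected_lcp:
  fixes R :: "nat set"
  assumes "m > 0" "finite R" "R \<noteq> {}"
    and B: "\<And>u. u < k \<Longrightarrow> B u \<subseteq> {1..n}"
    and B_less: "\<And>u v x y. u < v \<Longrightarrow> v < k \<Longrightarrow> x \<in> B u \<Longrightarrow> y \<in> B v \<Longrightarrow> x < y"
  shows "avg ({1..m} \<times> {1..n} \<rightarrow>\<^sub>E R) (\<lambda>c. real (card (match_labels R {1..m} B c k))) \<le> expected_lcp n m"
proof -
  define X where "X = PiE_dflt {1..m} (id :: nat \<Rightarrow> nat) (\<lambda>_. {p. p permutes {1..n}})"
  define Y where "Y = {1..m} \<times> {1..n} \<rightarrow>\<^sub>E R"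
  define U where "U c = real (card (match_labels R {1..m} B c k))" for c
  have finX: "finite X" unfolding X_def by (intro finite_PiE_dflt) (auto simp: finite_permutations)
  have "(\<lambda>_. id) \<in> X" by (auto simp: PiE_dflt_def X_def permutes_id)
  then have neX: "X \<noteq> {}" by blast
  have Y: "finite Y" "Y \<noteq> {}"
    using assms(2,3) by (auto simp: Y_def finite_PiE PiE_eq_empty_iff)
  have U_cong: "U c = U c'" if "\<And>i q. i \<in> {1..m} \<Longrightarrow> q \<in> {1..n} \<Longrightarrow> c (i, q) = c' (i, q)" for c c'
    unfolding U_def using B that
    by (intro arg_cong[where f = "\<lambda>x. real (card x)"] match_labels_cong) blast
  have X_perm: "P i permutes {1..n}" if "P \<in> X" "i \<in> {1..m}" for P i
    using that by (auto simp: X_def PiE_dflt_def)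
  have "avg Y U = avg X (\<lambda>P. avg Y U)"
    by (rule avg_const[OF finX neX, symmetric])
  also have "\<dots> = avg X (\<lambda>P. avg Y (\<lambda>c. U (\<lambda>(i, q). c (i, P i q))))"
  proof (rule avg_cong)
    fix P assume "P \<in> X"
    then have "bij_betw (\<lambda>c. restrict (\<lambda>(i, q). c (i, P i q)) ({1..m} \<times> {1..n})) Y Y"
      unfolding Y_def using X_perm by (intro bij_betw_relabel_positions) auto
    from avg_bij_betw[OF this, of U]
    have "avg Y U = avg Y (\<lambda>c. U (restrict (\<lambda>(i, q). c (i, P i q)) ({1..m} \<times> {1..n})))" by simp
    also have "\<dots> = avg Y (\<lambda>c. U (\<lambda>(i, q). c (i, P i q)))"
      by (intro avg_cong U_cong) auto
    finally show "avg Y U = avg Y (\<lambda>c. U (\<lambda>(i, q). c (i, P i q)))" .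
  qed
  also have "\<dots> = avg Y (\<lambda>c. avg X (\<lambda>P. U (\<lambda>(i, q). c (i, P i q))))"
    by (rule avg_swap)
  also have "\<dots> \<le> avg Y (\<lambda>c. avg X (\<lambda>P. real (lcp_length n m P)))"
  proof (rule avg_mono)
    fix c :: "nat \<times> nat \<Rightarrow> nat"
    have "\<exists>t. t permutes {1..n} \<and>
        (\<forall>x\<in>{1..n}. \<forall>y\<in>{1..n}. c (i, inv t x) < c (i, inv t y) \<longrightarrow> x < y)" for i
    proof -
      obtain t where "t permutes {1..n}"
        "\<And>x y. x \<in> {1..n} \<Longrightarrow> y \<in> {1..n} \<Longrightarrow> c (i, inv t x) < c (i, inv t y) \<Longrightarrow> x < y"
        using sorting_permutation[of n "\<lambda>q. c (i, q)"] by blast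
      then show ?thesis by blast
    qed
    then obtain s where s: "\<And>i. s i permutes {1..n}"
      "\<And>i x y. x \<in> {1..n} \<Longrightarrow> y \<in> {1..n} \<Longrightarrow> c (i, inv (s i) x) < c (i, inv (s i) y) \<Longrightarrow> x < y"
      by metis
    have "bij_betw (\<lambda>P i. if i \<in> {1..m} then inv (s i) \<circ> P i else id) X X"
      unfolding X_def using s(1) by (intro bij_betw_compose_perms permutes_inv)
    from avg_bij_betw[OF this, of "\<lambda>P. U (\<lambda>(i, q). c (i, P i q))"]
    have "avg X (\<lambda>P. U (\<lambda>(i, q). c (i, P i q))) =
      avg X (\<lambda>P. U (\<lambda>(i, q). c (i, (if i \<in> {1..m} then inv (s i) \<circ> P i else id) q)))" by simp
    also have "\<dots> = avg X (\<lambda>P. U (\<lambda>(i, q). c (i, inv (s i) (P i q))))"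
      by (intro avg_cong U_cong) auto
    also have "\<dots> \<le> avg X (\<lambda>P. real (lcp_length n m P))"
    proof (rule avg_mono)
      fix P assume P: "P \<in> X"
      have "card (match_labels R {1..m} B (\<lambda>(i, q). c (i, inv (s i) (P i q))) k) \<le> lcp_length n m P"
      proof (rule card_match_labels_le_lcp_length[OF \<open>m > 0\<close> _ B B_less])
        fix i a b assume i: "i \<in> {1..m}" "a \<in> {1..n}" "b \<in> {1..n}"
          "(case (i, a) of (i, q) \<Rightarrow> c (i, inv (s i) (P i q))) < (case (i, b) of (i, q) \<Rightarrow> c (i, inv (s i) (P i q)))"
        then have "P i a \<in> {1..n}" "P i b \<in> {1..n}"
          using permutes_in_image[OF X_perm[OF P i(1)]] by blast+
        with i(4) show "P i a < P i b" by (auto intro: s(2)[of _ _ i])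
      qed
      then show "U (\<lambda>(i, q). c (i, inv (s i) (P i q))) \<le> real (lcp_length n m P)"
        by (simp add: U_def)
    qed
    finally show "avg X (\<lambda>P. U (\<lambda>(i, q). c (i, P i q))) \<le> avg X (\<lambda>P. real (lcp_length n m P))" .
  qed
  also have "\<dots> = avg X (\<lambda>P. real (lcp_length n m P))"
    by (rule avg_const[OF Y])
  also have "\<dots> = expected_lcp n m"
    by (simp add: expected_lcp_eq_avg X_def sym_group_def)
  finally show ?thesis by (simp only: Y_def U_def[abs_def])
qed

section \<open>The bound for a fixed grid\<close>

text \<open>
  The grid has \<open>k\<close> rows and \<open>k\<close> columns of \<open>s\<close> consecutive positions; the positions beyond \<open>k * s\<close> are
  ignored. With \<open>v\<close> free rows at the end, the potential is \<open>exp (v * (- ln b))\<close>, and its average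
  is at most \<open>2 - b\<^sup>k\<close>. A bound on the average of \<open>v\<close> follows by replacing the exponential with its
  tangent at \<open>1/2\<close>; the best point of tangency would be the logarithm of \<open>2 - 1/e\<close>, about \<open>0.4899\<close>,
  and \<open>1/2\<close> is close enough to it.
\<close>

lemma expected_lcp_lower_bound:
  fixes b :: real
  assumes "m > 0" "k > 0" "k * s \<le> n" "0 < b" "b < 1"
    and b: "b = 1 - (1 - (1 - 1 / real k) ^ s) ^ m"
  shows "real k - (exp (- (1/2)) * (2 - b ^ k) - 1/2) / (- ln b) \<le> expected_lcp n m"
proof -
  define R where "R = {..<k}"
  define J where "J = {1..m}"
  define B where "B u = {u * s<..Suc u * s}" for u
  define L where "L = - ln b"
  have L: "L > 0" using assms by (simp add: L_def)
  have R: "finite R" "R \<noteq> {}" "card R = k" using assms by (auto simp: R_def)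
  have J: "finite J" "card J = m" by (auto simp: J_def)
  have Bs: "finite (B u)" "card (B u) = s" for u by (simp_all add: B_def)
  have B_less: "x < y" if "u < v" "x \<in> B u" "y \<in> B v" for u v x y
  proof -
    have "Suc u * s \<le> v * s" using that by (intro mult_right_mono) auto
    then show ?thesis using that by (auto simp: B_def)
  qed
  have dis: "disjoint_family B"
    unfolding disjoint_family_on_def using B_less by (metis disjoint_iff linorder_neqE_nat less_irrefl)
  have Bn: "B u \<subseteq> {1..n}" if "u < k" for u
  proof -
    have "Suc u * s \<le> k * s" using that by (intro mult_right_mono) auto
    then show ?thesis using assms(3) by (auto simp: B_def)
  qed
  let ?I = "J \<times> (\<Union>u<k. B u)"
  let ?D = "J \<times> {1..n} - ?I"
  let ?M = "\<lambda>c. match_labels R J B c k"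
  have un: "J \<times> {1..n} = ?I \<union> ?D" using Bn by blast
  have finI: "finite ?I" "finite ?D" using J Bs by auto
  have ne: "finite (?D \<rightarrow>\<^sub>E R)" "?D \<rightarrow>\<^sub>E R \<noteq> {}" "finite (?I \<rightarrow>\<^sub>E R)" "?I \<rightarrow>\<^sub>E R \<noteq> {}"
    using finI R by (auto simp: finite_PiE PiE_eq_empty_iff)
  have pointwise: "real (card (?M c)) \<ge> (real k + 1 / (2 * L)) + (- exp (- (1/2)) / L) * (1 / b) ^ card (R - ?M c)" for c
  proof -
    define v where "v = card (R - ?M c)"
    have sub: "?M c \<subseteq> R" by (rule match_labels_subset)
    then have "v = k - card (?M c)" "card (?M c) \<le> k"
      using R by (auto simp: v_def card_Diff_subset finite_subset card_mono[of R])
    then have v: "real (card (?M c)) = real k - real v" by simp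
    have "(1 / b) ^ v = exp (real v * L)"
      using \<open>0 < b\<close> by (simp add: L_def exp_minus exp_of_nat_mult power_one_over inverse_eq_divide)
    also have "\<dots> = exp (1/2) * exp (real v * L - 1/2)" by (simp flip: exp_add)
    also have "\<dots> \<ge> exp (1/2) * (1 + (real v * L - 1/2))"
      by (intro mult_left_mono exp_ge_add_one_self) auto
    finally have "exp (- (1/2)) * (1 / b) ^ v \<ge> exp (- (1/2)) * (exp (1/2) * (1/2 + real v * L))"
      by (intro mult_left_mono) auto
    also have "exp (- (1/2)) * (exp (1/2) * (1/2 + real v * L)) = 1/2 + real v * L"
      by (simp add: exp_minus field_simps)
    finally have "real v \<le> (exp (- (1/2)) * (1 / b) ^ v - 1/2) / L"
      using L by (simp add: field_simps)
    then show ?thesis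
      unfolding v v_def[symmetric] using L by (simp add: field_simps)
  qed
  have pot: "avg (?I \<rightarrow>\<^sub>E R) (\<lambda>c. (1 / b) ^ card (R - ?M c)) \<le> 2 - b ^ k"
  proof -
    have "avg (?I \<rightarrow>\<^sub>E R) (\<lambda>c. (1 / b) ^ card (R - ?M c)) \<le> 1 + b ^ k * ((1 / b) ^ card R - 1)"
      using J R Bs dis assms by (intro avg_match_potential_le) auto
    also have "\<dots> = 2 - b ^ k"
      using assms by (simp add: R algebra_simps power_one_over)
    finally show ?thesis .
  qed
  have "real k - (exp (- (1/2)) * (2 - b ^ k) - 1/2) / L =
        (real k + 1 / (2 * L)) + (- exp (- (1/2)) / L) * (2 - b ^ k)"
    using L by (simp add: field_simps)
  also have "\<dots> \<le> (real k + 1 / (2 * L)) + (- exp (- (1/2)) / L) * avg (?I \<rightarrow>\<^sub>E R) (\<lambda>c. (1 / b) ^ card (R - ?M c))"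
    using pot L by (intro add_left_mono mult_left_mono_neg) auto
  also have "\<dots> = avg (?I \<rightarrow>\<^sub>E R) (\<lambda>c. (real k + 1 / (2 * L)) + (- exp (- (1/2)) / L) * (1 / b) ^ card (R - ?M c))"
    by (simp only: avg_add avg_cmult avg_const[OF ne(3,4)])
  also have "\<dots> \<le> avg (?I \<rightarrow>\<^sub>E R) (\<lambda>c. real (card (?M c)))"
    by (intro avg_mono pointwise)
  also have "\<dots> = avg (?I \<rightarrow>\<^sub>E R) (\<lambda>a. avg (?D \<rightarrow>\<^sub>E R) (\<lambda>g. real (card (?M (\<lambda>x. if x \<in> ?I then a x else g x)))))"
  proof (rule avg_cong)
    fix a
    have "?M (\<lambda>x. if x \<in> ?I then a x else g x) = ?M a" for g
      by (rule match_labels_cong) auto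
    then show "real (card (?M a)) = avg (?D \<rightarrow>\<^sub>E R) (\<lambda>g. real (card (?M (\<lambda>x. if x \<in> ?I then a x else g x))))"
      by (simp only: avg_const[OF ne(1,2)])
  qed
  also have "\<dots> = avg (J \<times> {1..n} \<rightarrow>\<^sub>E R) (\<lambda>c. real (card (?M c)))"
    by (subst (2) un, rule avg_funcset_Un[symmetric]) (use finI in auto)
  also have "\<dots> \<le> expected_lcp n m"
    unfolding J_def using Bn B_less by (intro avg_match_labels_le_expected_lcp assms R) blast+
  finally show ?thesis by (simp add: L_def)
qed

section \<open>Asymptotics of the grid bound\<close>

text \<open>
  With \<open>x = exp (-1/2)\<close> the claim is \<open>x\<^sup>3 - 2 x + 1 \<ge> 0\<close>, and the left side factors as
  \<open>(1 - x) (1 - x - x\<^sup>2)\<close>. It is nonnegative because \<open>x\<close>, about \<open>0.6065\<close>, lies below the golden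
  section \<open>0.618\<close>; the bound \<open>x \<le> 8/13\<close> is just good enough.
\<close>

lemma limit_constant_ge_half: "1 - (exp (- (1/2)) * (2 - exp (-1)) - 1/2) \<ge> (1/2 :: real)"
proof -
  define x where "x = exp (- (1/2) :: real)"
  have "exp (1/2 :: real) \<ge> 13/8"
    using exp_lower_Taylor_quadratic[of "1/2 :: real"] by (simp add: power2_eq_square)
  then have x: "x \<le> 8/13" "x > 0" 
    by (auto simp: x_def exp_minus field_simps)
  have "exp (-1) = x ^ 2" by (simp add: x_def flip: exp_of_nat_mult)
  moreover have "x * (2 - x ^ 2) \<le> 1"
  proof -
    have "x * x \<le> (8/13) * (8/13)" using x by (intro mult_mono) auto
    then have "x * x + x \<le> 1" using x by simp
    then have "(1 - x) * (1 - x - x * x) \<ge> 0" using x by (intro mult_nonneg_nonneg) auto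
    then show ?thesis by (simp add: power2_eq_square algebra_simps)
  qed
  ultimately show ?thesis by (simp flip: x_def)
qed

text \<open>
  Let \<open>a = s / k\<close>, which is asymptotically \<open>n / k\<^sup>2\<close> and tends to \<open>0\<close>. Then \<open>p = 1 - (1 - 1/k)\<^sup>s\<close> lies
  between \<open>1 - exp (- a)\<close> and \<open>a\<close>, so \<open>p\<close> is asymptotic to \<open>a\<close>, and \<open>k * p\<^sup>m\<close> is asymptotic to
  \<open>k * (n / k\<^sup>2)\<^sup>m\<close>, which tends to \<open>1\<close> by the choice of \<open>\<gamma>\<close>. Hence \<open>k * (- ln b)\<close> tends to \<open>1\<close> as
  well, and \<open>b\<^sup>k\<close> to \<open>exp (-1)\<close>.
\<close>

lemma lower_bound_asymptotics:
  fixes m :: nat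
  assumes "m \<ge> 2"
  defines "\<gamma> \<equiv> real m / (2 * real m - 1)"
  defines "k \<equiv> \<lambda>n. nat \<lfloor>real n powr \<gamma>\<rfloor>"
  defines "s \<equiv> \<lambda>n. n div k n"
  defines "b \<equiv> \<lambda>n. 1 - (1 - (1 - 1 / real (k n)) ^ s n) ^ m"
  shows "eventually (\<lambda>n. k n > 0 \<and> 0 < b n \<and> b n < 1) at_top"
    and "(\<lambda>n. (real (k n) - (exp (- (1/2)) * (2 - b n ^ k n) - 1/2) / (- ln (b n))) / real n powr \<gamma>)
           \<longlonglongrightarrow> 1 - (exp (- (1/2)) * (2 - exp (-1)) - 1/2)"
proof -
  have \<gamma>: "1/2 < \<gamma>" "\<gamma> < 1" using assms(1) by (auto simp: \<gamma>_def field_simps)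
  define x where "x n = real n powr \<gamma>" for n :: nat
  define a where "a n = real (s n) / real (k n)" for n
  define p where "p n = 1 - (1 - 1 / real (k n)) ^ s n" for n
  define L where "L n = - ln (b n)" for n
  have b: "b n = 1 - p n ^ m" for n by (simp add: b_def p_def)
  have x_top: "filterlim x at_top at_top" unfolding x_def using \<gamma> by real_asymp
  have k_bounds: "real (k n) \<le> x n" "x n < real (k n) + 1" for n
    unfolding k_def x_def by (simp_all add: of_nat_nat)
  have ev_x: "eventually (\<lambda>n. x n > 2) at_top" using x_top by (simp add: filterlim_at_top_dense)
  have kx: "(\<lambda>n. real (k n) / x n) \<longlonglongrightarrow> 1"
  proof (rule tendsto_sandwich)
    show "eventually (\<lambda>n. 1 - 1 / x n \<le> real (k n) / x n) at_top"
      using ev_x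
    proof eventually_elim
      case (elim n)
      have "1 - 1 / x n = (x n - 1) / x n" using elim by (simp add: diff_divide_distrib)
      also have "\<dots> \<le> real (k n) / x n"
        using elim k_bounds(2)[of n] by (intro divide_right_mono) auto
      finally show ?case .
    qed
    show "eventually (\<lambda>n. real (k n) / x n \<le> 1) at_top"
      using ev_x by eventually_elim (use k_bounds in \<open>auto simp: field_simps\<close>)
    show "(\<lambda>n. 1 - 1 / x n) \<longlonglongrightarrow> 1"
      unfolding x_def using \<gamma> by real_asymp
  qed auto
  have ev_k: "eventually (\<lambda>n. k n > 1) at_top"
    using ev_x
  proof eventually_elim
    case (elim n)
    then show ?case using k_bounds(2)[of n] by linarith
  qed
  have xk: "(\<lambda>n. x n / real (k n)) \<longlonglongrightarrow> 1"
    using tendsto_inverse[OF kx] by simp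
  have s_bounds: "real n / real (k n) - 1 \<le> real (s n)" "real (s n) \<le> real n / real (k n)" for n
  proof -
    have "real (s n) = of_int \<lfloor>real n / real (k n)\<rfloor>"
      by (simp add: s_def floor_divide_of_nat_eq)
    then show "real n / real (k n) - 1 \<le> real (s n)" "real (s n) \<le> real n / real (k n)"
      by linarith+
  qed
  have xn: "(\<lambda>n. x n / real n) \<longlonglongrightarrow> 0" unfolding x_def using \<gamma> by real_asymp
  have ax: "(\<lambda>n. a n * real (k n) ^ 2 / real n) \<longlonglongrightarrow> 1"
  proof (rule tendsto_sandwich)
    show "eventually (\<lambda>n. 1 - x n / real n \<le> a n * real (k n) ^ 2 / real n) at_top"
      using ev_k eventually_gt_at_top[of 0]
    proof eventually_elim
      case (elim n)
      have "1 - x n / real n \<le> 1 - real (k n) / real n"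
        using k_bounds(1)[of n] by (intro diff_left_mono divide_right_mono) auto
      also have "\<dots> = (real n / real (k n) - 1) * real (k n) / real n"
        using elim by (simp add: field_simps)
      also have "\<dots> \<le> real (s n) * real (k n) / real n"
        using elim s_bounds by (intro divide_right_mono mult_right_mono) auto
      also have "\<dots> = a n * real (k n) ^ 2 / real n"
        using elim by (simp add: a_def power2_eq_square)
      finally show ?case .
    qed
    show "eventually (\<lambda>n. a n * real (k n) ^ 2 / real n \<le> 1) at_top"
      using ev_k eventually_gt_at_top[of 0]
    proof eventually_elim
      case (elim n)
      have "a n * real (k n) ^ 2 / real n = real (s n) * real (k n) / real n"
        using elim by (simp add: a_def power2_eq_square)
      also have "\<dots> \<le> (real n / real (k n)) * real (k n) / real n"
        using elim s_bounds by (intro divide_right_mono mult_right_mono) auto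
      also have "\<dots> = 1" using elim by simp
      finally show ?case .
    qed
    show "(\<lambda>n. 1 - x n / real n) \<longlonglongrightarrow> 1" using tendsto_diff[OF tendsto_const xn, of 1] by simp
  qed auto
  have n_xx: "(\<lambda>n. real n / x n ^ 2) \<longlonglongrightarrow> 0"
  proof -
    have "(\<lambda>n. real n powr (1 - 2 * \<gamma>)) \<longlonglongrightarrow> 0" using \<gamma> by real_asymp
    moreover have "eventually (\<lambda>n. real n powr (1 - 2 * \<gamma>) = real n / x n ^ 2) at_top"
      using eventually_gt_at_top[of 0]
      by eventually_elim (simp add: x_def powr_diff powr_power mult.commute)
    ultimately show ?thesis by (rule Lim_transform_eventually)
  qed
  have a0: "a \<longlonglongrightarrow> 0"
  proof -
    have "(\<lambda>n. (a n * real (k n) ^ 2 / real n) * (real n / x n ^ 2) * (x n / real (k n)) ^ 2) \<longlonglongrightarrow> 1 * 0 * 1 ^ 2"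
      by (intro tendsto_intros ax n_xx xk)
    moreover have "eventually (\<lambda>n. (a n * real (k n) ^ 2 / real n) * (real n / x n ^ 2) * (x n / real (k n)) ^ 2 = a n) at_top"
      using ev_k ev_x eventually_gt_at_top[of 0] by eventually_elim (simp add: power_divide)
    ultimately show ?thesis by (simp add: Lim_transform_eventually)
  qed
  have ev_a: "eventually (\<lambda>n. a n > 0) at_top"
  proof -
    have "eventually (\<lambda>n. a n * real (k n) ^ 2 / real n > 1/2) at_top"
      using order_tendstoD(1)[OF ax, of "1/2"] by simp
    then show ?thesis
    proof eventually_elim
      case (elim n)
      have "a n \<noteq> 0"
      proof
        assume "a n = 0"
        from elim show False unfolding \<open>a n = 0\<close> by simp
      qed
      moreover have "a n \<ge> 0" by (simp add: a_def)
      ultimately show ?case by linarith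
    qed
  qed
  have p_bounds: "1 - exp (- a n) \<le> p n" "p n \<le> a n" if "k n > 1" for n
  proof -
    have "(1 - 1 / real (k n)) ^ s n \<le> exp (- 1 / real (k n)) ^ s n"
      using that exp_ge_add_one_self[of "- 1 / real (k n)"] by (intro power_mono) auto
    also have "\<dots> = exp (- a n)" by (simp add: a_def flip: exp_of_nat_mult)
    finally show "1 - exp (- a n) \<le> p n" by (simp add: p_def)
    have "1 + real (s n) * (- 1 / real (k n)) \<le> (1 + (- 1 / real (k n))) ^ s n"
      using that by (intro Bernoulli_inequality) (auto simp: field_simps)
    then show "p n \<le> a n" by (simp add: p_def a_def)
  qed
  have a_right: "filterlim a (at_right 0) at_top"
    using a0 ev_a by (simp add: filterlim_at eventually_mono)
  have pa: "(\<lambda>n. p n / a n) \<longlonglongrightarrow> 1"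
  proof (rule tendsto_sandwich)
    show "eventually (\<lambda>n. (1 - exp (- a n)) / a n \<le> p n / a n) at_top"
      using ev_k ev_a by eventually_elim (use p_bounds in \<open>auto intro!: divide_right_mono\<close>)
    show "eventually (\<lambda>n. p n / a n \<le> 1) at_top"
      using ev_k ev_a by eventually_elim (use p_bounds in \<open>auto simp: field_simps\<close>)
    have "((\<lambda>y::real. (1 - exp (- y)) / y) \<longlongrightarrow> 1) (at_right 0)" by real_asymp
    from filterlim_compose[OF this a_right] show "(\<lambda>n. (1 - exp (- a n)) / a n) \<longlonglongrightarrow> 1" .
  qed auto
  have ev_p: "eventually (\<lambda>n. p n > 0) at_top"
    using ev_a ev_k
  proof eventually_elim
    case (elim n)
    have "exp (- a n) < 1" using elim by simp
    then show ?case using p_bounds(1)[of n] elim by linarith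
  qed
  have "p \<longlonglongrightarrow> 0"
  proof -
    have "(\<lambda>n. p n / a n * a n) \<longlonglongrightarrow> 1 * 0" by (intro tendsto_intros pa a0)
    moreover have "eventually (\<lambda>n. p n / a n * a n = p n) at_top"
      using ev_a by eventually_elim simp
    ultimately show ?thesis by (simp add: Lim_transform_eventually)
  qed
  then have pm0: "(\<lambda>n. p n ^ m) \<longlonglongrightarrow> 0"
    using tendsto_power[of p 0 _ m] assms(1) by (simp add: power_0_left)
  have ev_pm: "eventually (\<lambda>n. p n ^ m > 0) at_top"
    using ev_p by eventually_elim simp
  have pm_right: "filterlim (\<lambda>n. p n ^ m) (at_right 0) at_top"
    unfolding filterlim_at
  proof
    show "eventually (\<lambda>n. p n ^ m \<in> {0<..} \<and> p n ^ m \<noteq> 0) at_top"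
      using ev_p by eventually_elim simp
  qed (rule pm0)
  have ev_pm1: "eventually (\<lambda>n. p n ^ m < 1) at_top"
    using order_tendstoD(2)[OF pm0, of 1] by simp
  show "eventually (\<lambda>n. k n > 0 \<and> 0 < b n \<and> b n < 1) at_top"
    using ev_k ev_pm ev_pm1 by eventually_elim (auto simp: b)
  have kpm: "(\<lambda>n. real (k n) * p n ^ m) \<longlonglongrightarrow> 1"
  proof -
    have "(\<lambda>n. (real (k n) / x n) * (p n / a n) ^ m * (a n * real (k n) ^ 2 / real n) ^ m *
            ((x n / real (k n)) ^ 2) ^ m) \<longlonglongrightarrow> 1 * 1 ^ m * 1 ^ m * (1 ^ 2) ^ m"
      by (intro tendsto_intros kx pa ax xk)
    moreover have "eventually (\<lambda>n. (real (k n) / x n) * (p n / a n) ^ m * (a n * real (k n) ^ 2 / real n) ^ m *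
            ((x n / real (k n)) ^ 2) ^ m = real (k n) * p n ^ m) at_top"
      using ev_k ev_a ev_x eventually_gt_at_top[of 0]
    proof eventually_elim
      case (elim n)
      have "x n * (real n / x n ^ 2) ^ m = real n powr (\<gamma> + real m * (1 - 2 * \<gamma>))"
        using elim by (simp add: x_def powr_add powr_diff powr_power power_divide
            right_diff_distrib mult.commute mult.left_commute powr_realpow)
      also have "\<gamma> + real m * (1 - 2 * \<gamma>) = 0"
        using assms(1) by (simp add: \<gamma>_def field_simps)
      \<comment> \<open>This identity is where the exponent \<open>m / (2 m - 1)\<close> comes from.\<close>
      finally have xm: "x n * (real n / x n ^ 2) ^ m = 1" using elim by simp
      have "(p n / a n) ^ m * (a n * real (k n) ^ 2 / real n) ^ m * ((x n / real (k n)) ^ 2) ^ m =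
            (p n * (x n ^ 2 / real n)) ^ m"
        unfolding power_mult_distrib[symmetric] using elim
        by (intro arg_cong[where f = "\<lambda>y. y ^ m"]) (simp add: field_simps)
      also have "\<dots> = p n ^ m * (x n ^ 2 / real n) ^ m"
        by (rule power_mult_distrib)
      also have "(x n ^ 2 / real n) ^ m = x n"
        using xm elim by (simp add: field_simps)
      finally have "(real (k n) / x n) * ((p n / a n) ^ m * (a n * real (k n) ^ 2 / real n) ^ m *
          ((x n / real (k n)) ^ 2) ^ m) = (real (k n) / x n) * (p n ^ m * x n)"
        by simp
      then show ?case using elim by (simp add: mult.assoc)
    qed
    ultimately show ?thesis by (simp add: Lim_transform_eventually)
  qed
  have Lpm: "(\<lambda>n. L n / p n ^ m) \<longlonglongrightarrow> 1"
  proof -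
    have "((\<lambda>y::real. - ln (1 - y) / y) \<longlongrightarrow> 1) (at_right 0)" by real_asymp
    from filterlim_compose[OF this pm_right] show ?thesis by (simp add: L_def b)
  qed
  have kL: "(\<lambda>n. real (k n) * L n) \<longlonglongrightarrow> 1"
  proof -
    have "(\<lambda>n. (real (k n) * p n ^ m) * (L n / p n ^ m)) \<longlonglongrightarrow> 1 * 1"
      by (intro tendsto_intros kpm Lpm)
    moreover have "eventually (\<lambda>n. (real (k n) * p n ^ m) * (L n / p n ^ m) = real (k n) * L n) at_top"
      using ev_p by eventually_elim simp
    ultimately show ?thesis by (simp add: Lim_transform_eventually)
  qed
  have "(\<lambda>n. (real (k n) / x n) * (1 - (exp (- (1/2)) * (2 - exp (- (real (k n) * L n))) - 1/2) / (real (k n) * L n)))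
      \<longlonglongrightarrow> 1 * (1 - (exp (- (1/2)) * (2 - exp (- 1)) - 1/2) / 1)"
    by (intro tendsto_intros kx kL) auto
  moreover have "eventually (\<lambda>n. (real (k n) / x n) * (1 - (exp (- (1/2)) * (2 - exp (- (real (k n) * L n))) - 1/2) / (real (k n) * L n)) =
      (real (k n) - (exp (- (1/2)) * (2 - b n ^ k n) - 1/2) / (- ln (b n))) / real n powr \<gamma>) at_top"
    using ev_k ev_pm ev_pm1 ev_x
  proof eventually_elim
    case (elim n)
    have b01: "0 < b n" "b n < 1" using elim by (auto simp: b)
    have "exp (- (real (k n) * L n)) = exp (real (k n) * ln (b n))" by (simp add: L_def)
    also have "\<dots> = b n ^ k n" using b01 by (simp add: exp_of_nat_mult)
    finally have e: "exp (- (real (k n) * L n)) = b n ^ k n" .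
    have "L n > 0" using b01 by (simp add: L_def)
    have "(K / X) * (1 - E / (K * l)) = (K - E / l) / X" if "K > 0" "l > 0" for K X E l :: real
      using that by (cases "X = 0") (simp_all add: field_simps)
    note identity = this
    show ?case
      unfolding e x_def[symmetric] L_def[symmetric]
      by (rule identity) (use elim(1) \<open>L n > 0\<close> in simp_all)
  qed
  ultimately show "(\<lambda>n. (real (k n) - (exp (- (1/2)) * (2 - b n ^ k n) - 1/2) / (- ln (b n))) / real n powr \<gamma>)
           \<longlonglongrightarrow> 1 - (exp (- (1/2)) * (2 - exp (-1)) - 1/2)"
    by (simp add: Lim_transform_eventually)
qed

theorem theorem2:
  fixes m :: nat
  assumes "m \<ge> 2"
  shows "liminf (\<lambda>n. ereal (expected_lcp n m / real n powr (real m / (2 * real m - 1))))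
           \<ge> ereal (1 / 2)"
proof -
  define \<gamma> where "\<gamma> = real m / (2 * real m - 1)"
  define k where "k n = nat \<lfloor>real n powr \<gamma>\<rfloor>" for n :: nat
  define s where "s n = n div k n" for n
  define b where "b n = 1 - (1 - (1 - 1 / real (k n)) ^ s n) ^ m" for n
  define G where "G n = real (k n) - (exp (- (1/2)) * (2 - b n ^ k n) - 1/2) / (- ln (b n))" for n
  note lim = lower_bound_asymptotics[OF assms, folded \<gamma>_def, folded k_def, folded s_def, folded b_def]
  have "ereal (1 / 2) \<le> ereal (1 - (exp (- (1/2)) * (2 - exp (-1)) - 1/2))"
    using limit_constant_ge_half by simp
  also have "\<dots> = liminf (\<lambda>n. ereal (G n / real n powr \<gamma>))"
    using lim(2) by (intro lim_imp_Liminf[symmetric]) (auto simp: G_def)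
  also have "\<dots> \<le> liminf (\<lambda>n. ereal (expected_lcp n m / real n powr \<gamma>))"
  proof (rule Liminf_mono)
    show "eventually (\<lambda>n. ereal (G n / real n powr \<gamma>) \<le> ereal (expected_lcp n m / real n powr \<gamma>)) sequentially"
      using lim(1)
    proof eventually_elim
      case (elim n)
      have "G n \<le> expected_lcp n m"
        unfolding G_def using elim assms
        by (intro expected_lcp_lower_bound[where s = "s n"]) (auto simp: b_def s_def)
      then show ?case by (simp add: divide_right_mono)
    qed
  qed
  finally show ?thesis by (simp add: \<gamma>_def)
qed

end
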